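(* Let $G$ be a group, $k$ a field and $V$ a finite-dimensional representation of $G$ over $k$. Then the set $\mathcal L(V) \subset k[G]$ of Lie elements with respect to $V$ is a Lie subalgebra of $k[G]$, where $k[G]$ carries the Lie bracket $[p,q] = pq - qp$.
   Context: For $g \in G$ and $m \ge 1$ define linear operators $A_m(g), B_m(g): V^{\wedge m} \to V^{\wedge m}$ on the $m$-th exterior power by $$A_m(g)(v_1 \wedge \dots \wedge v_m) = g(v_1) \wedge \dots \wedge g(v_m),$$ $$B_m(g)(v_1 \wedge \dots \wedge v_m) = \sum_{p=1}^m v_1 \wedge \dots \wedge g(v_p) \wedge \dots \wedge v_m$$ (in the $p$-th summand only $v_p$ is replaced by $g(v_p)$). For $m = 0$ set $A_0(g) = 1$ and $B_0(g) = 0$ as operators $k \to k$. Extend $A_m$ and $B_m$ by $k$-linearity to maps $k[G] \to \operatorname{End}(V^{\wedge m})$. An element $x \in k[G]$ is called a Lie element (with respect to $V$) if $A_m(x) = B_m(x)$ for all $m = 0, 1, \dots, \dim V$; the set of Lie elements is denoted $\mathcal L(V)$. *)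

theory Defs
  imports "HOL.Vector_Spaces" "HOL-Library.Poly_Mapping" "HOL-Library.FuncSet"
begin

section \<open>Free vector spaces and the group algebra\<close>

text \<open>
  For a field \<open>'k\<close>, the type \<open>'a \<Rightarrow>\<^sub>0 'k\<close> of finitely supported functions is the free
  vector space on \<open>'a\<close>; the basis vector belonging to \<open>a\<close> is \<open>single a 1\<close>.
  If \<open>'g :: group_add\<close>, the library multiplication on \<open>'g \<Rightarrow>\<^sub>0 'k\<close> is convolution, so
  this type is the group algebra of \<open>'g\<close>.  The class \<open>group_add\<close> consists of arbitrary, not
  necessarily commutative groups; only the notation is additive: the neutral element is \<open>0\<close>
  and the product of \<open>g\<close> and \<open>h\<close> is \<open>g + h\<close>.
\<close>

definition fscale :: "'k::field \<Rightarrow> ('a \<Rightarrow>\<^sub>0 'k) \<Rightarrow> ('a \<Rightarrow>\<^sub>0 'k)" where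
  "fscale c = Poly_Mapping.map ((*) c)"

lemma lookup_fscale [simp]: "Poly_Mapping.lookup (fscale c p) a = c * Poly_Mapping.lookup p a"
  by (simp add: fscale_def Poly_Mapping.map.rep_eq when_def)

global_interpretation free: vector_space fscale
  by unfold_locales (auto intro!: poly_mapping_eqI simp: lookup_add algebra_simps)

definition fextend :: "('a \<Rightarrow> ('b \<Rightarrow>\<^sub>0 'k::field)) \<Rightarrow> ('a \<Rightarrow>\<^sub>0 'k) \<Rightarrow> ('b \<Rightarrow>\<^sub>0 'k)" where
  "fextend f p = (\<Sum>a\<in>Poly_Mapping.keys p. fscale (Poly_Mapping.lookup p a) (f a))"

lemma fextend_superset:
  fixes p :: "'a \<Rightarrow>\<^sub>0 'k::field"
  assumes "finite K" "Poly_Mapping.keys p \<subseteq> K"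
  shows "fextend f p = (\<Sum>a\<in>K. fscale (Poly_Mapping.lookup p a) (f a))"
  unfolding fextend_def
  by (rule sum.mono_neutral_left) (use assms in \<open>auto simp: in_keys_iff\<close>)

lemma linear_fextend: "Vector_Spaces.linear fscale fscale (fextend (f :: 'a \<Rightarrow> ('b \<Rightarrow>\<^sub>0 'k::field)))"
proof (unfold_locales)
  fix p q :: "'a \<Rightarrow>\<^sub>0 'k" and c :: 'k
  let ?K = "Poly_Mapping.keys p \<union> Poly_Mapping.keys q"
  have "Poly_Mapping.keys (p + q) \<subseteq> ?K" by (rule keys_add)
  then show "fextend f (p + q) = fextend f p + fextend f q"
    by (simp add: fextend_superset[where K = ?K] lookup_add free.scale_left_distrib sum.distrib)
  have "Poly_Mapping.keys (fscale c p) \<subseteq> Poly_Mapping.keys p" by (auto simp: in_keys_iff)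
  then show "fextend f (fscale c p) = fscale c (fextend f p)"
    by (simp add: fextend_superset[where K = "Poly_Mapping.keys p"] free.scale_sum_right)
qed

lemma fextend_single [simp]: "fextend f (Poly_Mapping.single a c) = fscale c (f a)"
  by (simp add: fextend_superset[where K = "{a}"])

lemma sum_lessThan_add:
  fixes f :: "nat \<Rightarrow> 'a::comm_monoid_add"
  shows "(\<Sum>p<m + n. f p) = (\<Sum>p<m. f p) + (\<Sum>p<n. f (m + p))"
  by (induction n) (simp_all add: add.assoc)

definition lie_bracket :: "('g::group_add \<Rightarrow>\<^sub>0 'k::field) \<Rightarrow> ('g \<Rightarrow>\<^sub>0 'k) \<Rightarrow> ('g \<Rightarrow>\<^sub>0 'k)" where
  "lie_bracket p q = p * q - q * p"

definition lie_subalgebra :: "('g::group_add \<Rightarrow>\<^sub>0 'k::field) set \<Rightarrow> bool" where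
  "lie_subalgebra L \<longleftrightarrow> free.subspace L \<and> (\<forall>p\<in>L. \<forall>q\<in>L. lie_bracket p q \<in> L)"

section \<open>Exterior powers\<close>

context vector_space
begin

text \<open>
  The \<open>m\<close>-th exterior power is the quotient of the free vector space on all \<open>m\<close>-tuples
  of vectors (lists of length \<open>m\<close>) by the subspace spanned by the relations expressing that
  \<open>v\<^sub>1 \<and> \<dots> \<and> v\<^sub>m\<close> is additive and homogeneous in each slot and vanishes if two of the
  vectors are equal.  For \<open>m = 0\<close> there are no relations and the only tuple is \<open>[]\<close>, so
  the quotient is the one-dimensional space with basis vector \<open>wedge []\<close>, i.e. the ground
  field.
\<close>

definition ext_free :: "nat \<Rightarrow> ('b list \<Rightarrow>\<^sub>0 'a) set" where
  "ext_free m = {t. \<forall>vs\<in>Poly_Mapping.keys t. length vs = m}"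

definition ext_relators :: "nat \<Rightarrow> ('b list \<Rightarrow>\<^sub>0 'a) set" where
  "ext_relators m =
     {Poly_Mapping.single (xs @ (v + w) # ys) 1 - Poly_Mapping.single (xs @ v # ys) 1 - Poly_Mapping.single (xs @ w # ys) 1 | xs v w ys.
        length xs + 1 + length ys = m}
   \<union> {Poly_Mapping.single (xs @ (c *s v) # ys) 1 - fscale c (Poly_Mapping.single (xs @ v # ys) 1) | xs c v ys.
        length xs + 1 + length ys = m}
   \<union> {Poly_Mapping.single vs 1 | vs. length vs = m \<and> \<not> distinct vs}"

definition ext_null :: "nat \<Rightarrow> ('b list \<Rightarrow>\<^sub>0 'a) set" where
  "ext_null m = free.span (ext_relators m)"

definition ext_rel :: "nat \<Rightarrow> (('b list \<Rightarrow>\<^sub>0 'a) \<times> ('b list \<Rightarrow>\<^sub>0 'a)) set" where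
  "ext_rel m = {(s, t). s \<in> ext_free m \<and> t \<in> ext_free m \<and> s - t \<in> ext_null m}"

definition ext_power :: "nat \<Rightarrow> ('b list \<Rightarrow>\<^sub>0 'a) set set" where
  "ext_power m = ext_free m // ext_rel m"

definition wedge :: "'b list \<Rightarrow> ('b list \<Rightarrow>\<^sub>0 'a) set" where
  "wedge vs = ext_rel (length vs) `` {Poly_Mapping.single vs 1}"

definition ext_add :: "nat \<Rightarrow> ('b list \<Rightarrow>\<^sub>0 'a) set \<Rightarrow> ('b list \<Rightarrow>\<^sub>0 'a) set \<Rightarrow> ('b list \<Rightarrow>\<^sub>0 'a) set" where
  "ext_add m X Y = (\<Union>s\<in>X. \<Union>t\<in>Y. ext_rel m `` {s + t})"

definition ext_scale :: "nat \<Rightarrow> 'a \<Rightarrow> ('b list \<Rightarrow>\<^sub>0 'a) set \<Rightarrow> ('b list \<Rightarrow>\<^sub>0 'a) set" where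
  "ext_scale m c X = (\<Union>t\<in>X. ext_rel m `` {fscale c t})"

text \<open>
  The operator on the exterior power induced by a linear operator on the free space that
  preserves \<open>ext_free m\<close> and \<open>ext_null m\<close>.
\<close>

definition ext_induced ::
  "nat \<Rightarrow> (('b list \<Rightarrow>\<^sub>0 'a) \<Rightarrow> ('b list \<Rightarrow>\<^sub>0 'a)) \<Rightarrow> ('b list \<Rightarrow>\<^sub>0 'a) set \<Rightarrow> ('b list \<Rightarrow>\<^sub>0 'a) set" where
  "ext_induced m f = (\<lambda>X\<in>ext_power m. \<Union>t\<in>X. ext_rel m `` {f t})"

lemma subspace_ext_free: "free.subspace (ext_free m)"
  unfolding free.subspace_def ext_free_def
  by (auto simp: in_keys_iff lookup_add)

lemma single_in_ext_free [simp]: "Poly_Mapping.single vs c \<in> ext_free m \<longleftrightarrow> c = 0 \<or> length vs = m"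
  by (auto simp: ext_free_def)

lemma equiv_ext_rel: "equiv (ext_free m) (ext_rel m)"
proof (rule equivI)
  show "ext_rel m \<subseteq> ext_free m \<times> ext_free m"
    by (auto simp: ext_rel_def)
  show "refl_on (ext_free m) (ext_rel m)"
    by (auto simp: refl_on_def ext_rel_def ext_null_def free.span_zero)
  show "sym (ext_rel m)"
    unfolding sym_def ext_rel_def ext_null_def
    using free.span_neg[of _ "ext_relators m"] by fastforce
  show "trans (ext_rel m)"
    unfolding trans_def ext_rel_def ext_null_def
    using free.span_add[of _ "ext_relators m"] by fastforce
qed

lemma ext_class_eq:
  "s \<in> ext_free m \<Longrightarrow> t \<in> ext_free m \<Longrightarrow>
    ext_rel m `` {s} = ext_rel m `` {t} \<longleftrightarrow> s - t \<in> ext_null m"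
  using eq_equiv_class_iff[OF equiv_ext_rel, of s m t] by (simp add: ext_rel_def)

lemma ext_class_in_ext_power: "t \<in> ext_free m \<Longrightarrow> ext_rel m `` {t} \<in> ext_power m"
  by (simp add: ext_power_def quotientI)

lemma ext_power_cases:
  assumes "X \<in> ext_power m"
  obtains t where "t \<in> ext_free m" "X = ext_rel m `` {t}"
  using assms unfolding ext_power_def by (rule quotientE)

lemma ext_add_class:
  assumes "s \<in> ext_free m" "t \<in> ext_free m"
  shows "ext_add m (ext_rel m `` {s}) (ext_rel m `` {t}) = ext_rel m `` {s + t}"
  unfolding ext_add_def
proof (rule UN_equiv_class2[OF equiv_ext_rel equiv_ext_rel _ assms])
  show "congruent2 (ext_rel m) (ext_rel m) (\<lambda>s t. ext_rel m `` {s + t})"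
  proof (rule congruent2I')
    fix s s' t t' assume *: "(s, s') \<in> ext_rel m" "(t, t') \<in> ext_rel m"
    then have "(s - s') + (t - t') \<in> ext_null m"
      unfolding ext_rel_def ext_null_def by (auto intro!: free.span_add)
    then have "(s + t) - (s' + t') \<in> ext_null m" by (simp add: algebra_simps)
    then show "ext_rel m `` {s + t} = ext_rel m `` {s' + t'}"
      using * by (subst ext_class_eq) (auto simp: ext_rel_def intro: free.subspace_add[OF subspace_ext_free])
  qed
qed

lemma ext_induced_class:
  assumes f: "Vector_Spaces.linear fscale fscale f"
    and f_free: "\<And>t. t \<in> ext_free m \<Longrightarrow> f t \<in> ext_free m"
    and f_null: "\<And>t. t \<in> ext_relators m \<Longrightarrow> f t \<in> ext_null m"
    and t: "t \<in> ext_free m"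
  shows "ext_induced m f (ext_rel m `` {t}) = ext_rel m `` {f t}"
proof -
  interpret f: Vector_Spaces.linear fscale fscale f by (rule f)
  have null: "f t \<in> ext_null m" if "t \<in> ext_null m" for t
  proof -
    have "f ` free.span (ext_relators m) \<subseteq> free.span (ext_null m)"
      using f_null unfolding f.span_image [symmetric] by (intro free.span_mono) blast
    then show ?thesis using that by (auto simp: ext_null_def free.span_span)
  qed
  have "(\<lambda>t. ext_rel m `` {f t}) respects ext_rel m"
  proof (rule congruentI)
    fix s t assume *: "(s, t) \<in> ext_rel m"
    then have "f s - f t \<in> ext_null m" using null[of "s - t"] by (simp add: ext_rel_def f.diff)
    then show "ext_rel m `` {f s} = ext_rel m `` {f t}"
      using * by (subst ext_class_eq) (auto simp: ext_rel_def f_free)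
  qed
  then show ?thesis
    using t UN_equiv_class[OF equiv_ext_rel, of m "\<lambda>t. ext_rel m `` {f t}" t]
    by (simp add: ext_induced_def ext_class_in_ext_power)
qed

lemma ext_scale_class:
  assumes "t \<in> ext_free m"
  shows "ext_scale m c (ext_rel m `` {t}) = ext_rel m `` {fscale c t}"
proof -
  have lin: "Vector_Spaces.linear fscale fscale (fscale c)"
    by unfold_locales (auto simp: free.scale_right_distrib)
  have "ext_induced m (fscale c) (ext_rel m `` {t}) = ext_rel m `` {fscale c t}"
    by (rule ext_induced_class[OF lin _ _ assms])
       (auto simp: ext_null_def intro: free.span_scale free.span_base free.subspace_scale[OF subspace_ext_free])
  then show ?thesis using assms by (simp add: ext_induced_def ext_scale_def ext_class_in_ext_power)
qed

lemma ext_relator_add: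
  "length xs + 1 + length ys = m \<Longrightarrow>
    Poly_Mapping.single (xs @ (v + w) # ys) 1 - Poly_Mapping.single (xs @ v # ys) 1 - Poly_Mapping.single (xs @ w # ys) 1 \<in> ext_null m"
  unfolding ext_null_def by (rule free.span_base) (unfold ext_relators_def, blast)

lemma ext_relator_scale:
  "length xs + 1 + length ys = m \<Longrightarrow>
    Poly_Mapping.single (xs @ (c *s v) # ys) 1 - fscale c (Poly_Mapping.single (xs @ v # ys) 1) \<in> ext_null m"
  unfolding ext_null_def by (rule free.span_base) (unfold ext_relators_def, blast)

lemma ext_relator_repeat:
  "length vs = m \<Longrightarrow> \<not> distinct vs \<Longrightarrow> Poly_Mapping.single vs 1 \<in> ext_null m"
  unfolding ext_null_def by (rule free.span_base) (unfold ext_relators_def, blast)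

lemma ext_relator_swap:
  assumes "length xs + length ys + length zs + 2 = m"
  shows "Poly_Mapping.single (xs @ v # ys @ w # zs) 1 + Poly_Mapping.single (xs @ w # ys @ v # zs) 1 \<in> ext_null m"
proof -
  let ?s = "\<lambda>a b. Poly_Mapping.single (xs @ a # ys @ b # zs) 1 :: 'b list \<Rightarrow>\<^sub>0 'a"
  have 1: "?s (v + w) (v + w) - ?s v (v + w) - ?s w (v + w) \<in> ext_null m"
    using ext_relator_add[of xs "ys @ (v + w) # zs" m v w] assms by simp
  have 2: "?s a (v + w) - ?s a v - ?s a w \<in> ext_null m" for a
    using ext_relator_add[of "xs @ a # ys" zs m v w] assms by simp
  have 3: "?s a a \<in> ext_null m" for a
    using ext_relator_repeat[of "xs @ a # ys @ a # zs" m] assms by simp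
  have "?s v w + ?s w v = ?s (v + w) (v + w) - (?s (v + w) (v + w) - ?s v (v + w) - ?s w (v + w))
      - (?s v (v + w) - ?s v v - ?s v w) - (?s w (v + w) - ?s w v - ?s w w) - ?s v v - ?s w w"
    by simp
  also have "\<dots> \<in> ext_null m"
    using 1 2[of v] 2[of w] 3[of v] 3[of w] 3[of "v + w"]
      free.span_diff[of _ "ext_relators m", folded ext_null_def] by presburger
  finally show ?thesis .
qed

end

section \<open>Representations and Lie elements\<close>

locale group_representation = vector_space scale
  for scale :: "'k::field \<Rightarrow> 'v::ab_group_add \<Rightarrow> 'v" +
  fixes rep :: "'g::group_add \<Rightarrow> 'v \<Rightarrow> 'v"
  assumes linear_rep: "Vector_Spaces.linear scale scale (rep g)"
    and rep_0: "rep 0 v = v"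
    and rep_add: "rep (g + h) v = rep g (rep h v)"
begin

definition free_A :: "'g \<Rightarrow> 'v list \<Rightarrow> ('v list \<Rightarrow>\<^sub>0 'k)" where
  "free_A g vs = Poly_Mapping.single (map (rep g) vs) 1"

definition free_B :: "'g \<Rightarrow> 'v list \<Rightarrow> ('v list \<Rightarrow>\<^sub>0 'k)" where
  "free_B g vs = (\<Sum>p<length vs. Poly_Mapping.single (vs[p := rep g (vs ! p)]) 1)"

text \<open>
  \<open>A\<^sub>m(x)\<close> and \<open>B\<^sub>m(x)\<close> for \<open>x = \<Sum>\<^sub>g x\<^sub>g g\<close> in the group algebra are the operators induced by
  \<open>\<Sum>\<^sub>g x\<^sub>g A\<^sub>m(g)\<close> and \<open>\<Sum>\<^sub>g x\<^sub>g B\<^sub>m(g)\<close>; the lemmas below confirm that they are well defined, linear,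
  have the defining values on \<open>v\<^sub>1 \<and> \<dots> \<and> v\<^sub>m\<close>, and depend linearly on \<open>x\<close>.  They are
  extensional functions (\<open>undefined\<close> outside the exterior power), so equality
  of operators is equality of functions.
\<close>

definition op_A :: "nat \<Rightarrow> ('g \<Rightarrow>\<^sub>0 'k) \<Rightarrow> ('v list \<Rightarrow>\<^sub>0 'k) set \<Rightarrow> ('v list \<Rightarrow>\<^sub>0 'k) set" where
  "op_A m x = ext_induced m (\<lambda>t. fextend (\<lambda>g. fextend (free_A g) t) x)"

definition op_B :: "nat \<Rightarrow> ('g \<Rightarrow>\<^sub>0 'k) \<Rightarrow> ('v list \<Rightarrow>\<^sub>0 'k) set \<Rightarrow> ('v list \<Rightarrow>\<^sub>0 'k) set" where
  "op_B m x = ext_induced m (\<lambda>t. fextend (\<lambda>g. fextend (free_B g) t) x)"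

definition lie_elements :: "('g \<Rightarrow>\<^sub>0 'k) set" where
  "lie_elements = {x. \<forall>m\<le>dim UNIV. op_A m x = op_B m x}"

lemma fextend_in_ext_free:
  assumes "\<And>vs. length vs = m \<Longrightarrow> f vs \<in> ext_free m" "t \<in> ext_free m"
  shows "fextend f t \<in> ext_free m"
  unfolding fextend_def
proof (intro free.subspace_sum[OF subspace_ext_free] free.subspace_scale[OF subspace_ext_free])
  fix vs assume "vs \<in> Poly_Mapping.keys t"
  then have "length vs = m" using assms(2) by (auto simp: ext_free_def)
  then show "f vs \<in> ext_free m" by (rule assms(1))
qed

lemma free_A_in_ext_free: "length vs = m \<Longrightarrow> free_A g vs \<in> ext_free m"
  by (simp add: free_A_def)

lemma free_B_in_ext_free: "length vs = m \<Longrightarrow> free_B g vs \<in> ext_free m"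
  by (simp add: free_B_def free.subspace_sum[OF subspace_ext_free])

lemma fextend_free_A_null:
  assumes "t \<in> ext_relators m"
  shows "fextend (free_A g) t \<in> ext_null m"
proof -
  interpret r: Vector_Spaces.linear scale scale "rep g" by (rule linear_rep)
  interpret e: Vector_Spaces.linear fscale fscale "fextend (free_A g)" by (rule linear_fextend)
  from assms show ?thesis unfolding ext_relators_def
    by (auto simp: e.diff e.scale free_A_def r.add r.scale distinct_map
        intro!: ext_relator_add ext_relator_scale ext_relator_repeat)
qed

lemma free_B_append:
  "free_B g (xs @ v # ys) =
     (\<Sum>p<length xs. Poly_Mapping.single (xs[p := rep g (xs ! p)] @ v # ys) 1) + Poly_Mapping.single (xs @ rep g v # ys) 1
   + (\<Sum>p<length ys. Poly_Mapping.single (xs @ v # ys[p := rep g (ys ! p)]) 1)"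
proof -
  let ?f = "\<lambda>p. Poly_Mapping.single ((xs @ v # ys)[p := rep g ((xs @ v # ys) ! p)]) (1::'k)"
  have "free_B g (xs @ v # ys) = (\<Sum>p<length xs + Suc (length ys). ?f p)"
    by (simp add: free_B_def)
  also have "\<dots> = (\<Sum>p<length xs. ?f p) + (\<Sum>p<Suc (length ys). ?f (length xs + p))"
    by (rule sum_lessThan_add)
  also have "(\<Sum>p<length xs. ?f p) = (\<Sum>p<length xs. Poly_Mapping.single (xs[p := rep g (xs ! p)] @ v # ys) 1)"
    by (rule sum.cong) (auto simp: nth_append list_update_append)
  also have "(\<Sum>p<Suc (length ys). ?f (length xs + p)) =
      Poly_Mapping.single (xs @ rep g v # ys) 1 + (\<Sum>p<length ys. Poly_Mapping.single (xs @ v # ys[p := rep g (ys ! p)]) 1)"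
    unfolding sum.lessThan_Suc_shift by (simp add: nth_append list_update_append)
  finally show ?thesis by (simp add: add.assoc)
qed

lemma fextend_free_B_null:
  assumes "t \<in> ext_relators m"
  shows "fextend (free_B g) t \<in> ext_null m"
proof -
  interpret r: Vector_Spaces.linear scale scale "rep g" by (rule linear_rep)
  interpret e: Vector_Spaces.linear fscale fscale "fextend (free_B g)" by (rule linear_fextend)
  note null = free.span_sum[of _ _ "ext_relators m", folded ext_null_def]
    free.span_add[of _ "ext_relators m", folded ext_null_def]
  consider (add) xs v w ys where
      "t = Poly_Mapping.single (xs @ (v + w) # ys) 1 - Poly_Mapping.single (xs @ v # ys) 1 - Poly_Mapping.single (xs @ w # ys) 1"
      "length xs + 1 + length ys = m"
    | (scale) xs c v ys where
      "t = Poly_Mapping.single (xs @ scale c v # ys) 1 - fscale c (Poly_Mapping.single (xs @ v # ys) 1)"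
      "length xs + 1 + length ys = m"
    | (repeat) vs where "t = Poly_Mapping.single vs 1" "length vs = m" "\<not> distinct vs"
    using assms unfolding ext_relators_def by blast
  then show ?thesis
  proof cases
    case add
    let ?r = "\<lambda>xs v w ys. Poly_Mapping.single (xs @ (v + w) # ys) (1::'k) - Poly_Mapping.single (xs @ v # ys) 1 - Poly_Mapping.single (xs @ w # ys) 1"
    have "fextend (free_B g) t =
        (\<Sum>p<length xs. ?r (xs[p := rep g (xs ! p)]) v w ys) + ?r xs (rep g v) (rep g w) ys
      + (\<Sum>p<length ys. ?r xs v w (ys[p := rep g (ys ! p)]))"
      unfolding add(1) by (simp add: e.diff free_B_append r.add sum_subtractf)
    also have "\<dots> \<in> ext_null m"
      using add(2) by (intro null ext_relator_add) auto
    finally show ?thesis .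
  next
    case scale
    let ?r = "\<lambda>xs v ys. Poly_Mapping.single (xs @ scale c v # ys) 1 - fscale c (Poly_Mapping.single (xs @ v # ys) 1)"
    have "fextend (free_B g) t =
        (\<Sum>p<length xs. ?r (xs[p := rep g (xs ! p)]) v ys) + ?r xs (rep g v) ys
      + (\<Sum>p<length ys. ?r xs v (ys[p := rep g (ys ! p)]))"
      unfolding scale(1)
      by (simp add: e.diff e.scale free_B_append r.scale sum_subtractf free.scale_right_distrib
          free.scale_sum_right)
    also have "\<dots> \<in> ext_null m"
      using scale(2) by (intro null ext_relator_scale) auto
    finally show ?thesis .
  next
    case repeat
    from \<open>\<not> distinct vs\<close> obtain xs ys zs v where vs: "vs = xs @ [v] @ ys @ [v] @ zs"
      using not_distinct_decomp by blast
    have "free_B g vs =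
        (\<Sum>p<length xs. Poly_Mapping.single (xs[p := rep g (xs ! p)] @ v # ys @ v # zs) 1)
      + (\<Sum>p<length ys. Poly_Mapping.single (xs @ v # ys[p := rep g (ys ! p)] @ v # zs) 1)
      + (\<Sum>p<length zs. Poly_Mapping.single (xs @ v # ys @ v # zs[p := rep g (zs ! p)]) 1)
      + (Poly_Mapping.single (xs @ rep g v # ys @ v # zs) 1 + Poly_Mapping.single (xs @ v # ys @ rep g v # zs) 1)"
      using free_B_append[of g xs v "ys @ v # zs"]
      unfolding vs length_append length_Cons sum_lessThan_add sum.lessThan_Suc_shift
      by (simp add: nth_append list_update_append algebra_simps)
    also have "\<dots> \<in> ext_null m"
      using repeat(2) by (intro null ext_relator_repeat ext_relator_swap) (auto simp: vs)
    finally show ?thesis by (simp add: repeat(1))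
  qed
qed

lemma fextend_fextend_linear:
  fixes f :: "'g \<Rightarrow> 'v list \<Rightarrow> ('v list \<Rightarrow>\<^sub>0 'k)"
  shows "Vector_Spaces.linear fscale fscale (\<lambda>t. fextend (\<lambda>g. fextend (f g) t) x)"
proof -
  note module_hom = linear_fextend[of "f g" for g, unfolded Vector_Spaces.linear_def, THEN conjunct2, THEN conjunct2]
  show ?thesis unfolding fextend_def[of _ x]
    by unfold_locales
      (simp_all add: module_hom.add[OF module_hom] module_hom.scale[OF module_hom]
        free.scale_right_distrib sum.distrib free.scale_sum_right mult.commute)
qed

lemma fextend_free_in_ext_free:
  assumes "t \<in> ext_free m"
  shows "fextend (\<lambda>g. fextend (free_A g) t) x \<in> ext_free m"
    and "fextend (\<lambda>g. fextend (free_B g) t) x \<in> ext_free m"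
  unfolding fextend_def[of _ x]
  by (intro free.subspace_sum[OF subspace_ext_free] free.subspace_scale[OF subspace_ext_free]
      fextend_in_ext_free assms free_A_in_ext_free free_B_in_ext_free; assumption)+

lemma fextend_free_null:
  assumes "t \<in> ext_relators m"
  shows "fextend (\<lambda>g. fextend (free_A g) t) x \<in> ext_null m"
    and "fextend (\<lambda>g. fextend (free_B g) t) x \<in> ext_null m"
  using fextend_free_A_null[OF assms] fextend_free_B_null[OF assms]
  unfolding fextend_def[of _ x] ext_null_def
  by (auto intro!: free.span_sum free.span_scale)

lemma op_A_class:
  "t \<in> ext_free m \<Longrightarrow>
    op_A m x (ext_rel m `` {t}) = ext_rel m `` {fextend (\<lambda>g. fextend (free_A g) t) x}"
  unfolding op_A_def
  by (intro ext_induced_class fextend_fextend_linear fextend_free_in_ext_free fextend_free_null)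

lemma op_B_class:
  "t \<in> ext_free m \<Longrightarrow>
    op_B m x (ext_rel m `` {t}) = ext_rel m `` {fextend (\<lambda>g. fextend (free_B g) t) x}"
  unfolding op_B_def
  by (intro ext_induced_class fextend_fextend_linear fextend_free_in_ext_free fextend_free_null)

lemma op_A_wedge:
  "length vs = m \<Longrightarrow> op_A m (Poly_Mapping.single g 1) (wedge vs) = wedge (map (rep g) vs)"
  by (auto simp: wedge_def op_A_class free_A_def)

lemma op_B_wedge:
  "length vs = m \<Longrightarrow> op_B m (Poly_Mapping.single g 1) (wedge vs) =
    ext_rel m `` {\<Sum>p<m. Poly_Mapping.single (vs[p := rep g (vs ! p)]) 1}"
  by (auto simp: wedge_def op_B_class free_B_def)

lemma op_0:
  assumes "X \<in> ext_power 0"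
  shows "op_A 0 (Poly_Mapping.single g 1) X = X"
    and "op_B 0 (Poly_Mapping.single g 1) X = ext_rel 0 `` {0}"
proof -
  from assms obtain t where t: "t \<in> ext_free 0" and X: "X = ext_rel 0 `` {t}"
    by (rule ext_power_cases)
  have "t = Poly_Mapping.single [] (Poly_Mapping.lookup t [])"
  proof (rule poly_mapping_eqI)
    fix vs show "Poly_Mapping.lookup t vs = Poly_Mapping.lookup (Poly_Mapping.single [] (Poly_Mapping.lookup t [])) vs"
      using t by (cases vs) (auto simp: ext_free_def lookup_single_not_eq in_keys_iff)
  qed
  then obtain c where c: "t = Poly_Mapping.single [] c" by blast
  have [simp]: "fscale c (Poly_Mapping.single [] 1) = Poly_Mapping.single ([] :: 'v list) c"
    by (intro poly_mapping_eqI) (simp add: lookup_single when_def)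
  show "op_A 0 (Poly_Mapping.single g 1) X = X"
    and "op_B 0 (Poly_Mapping.single g 1) X = ext_rel 0 `` {0}"
    unfolding X using t by (simp_all add: op_A_class op_B_class c free_A_def free_B_def)
qed

lemma op_in_ext_power:
  assumes "X \<in> ext_power m"
  shows "op_A m x X \<in> ext_power m" "op_B m x X \<in> ext_power m"
  using assms
  by (auto elim!: ext_power_cases simp: op_A_class op_B_class
      intro!: ext_class_in_ext_power fextend_free_in_ext_free)

lemma op_linear:
  assumes "X \<in> ext_power m" "Y \<in> ext_power m"
  shows "op_A m x (ext_add m X Y) = ext_add m (op_A m x X) (op_A m x Y)"
    and "op_B m x (ext_add m X Y) = ext_add m (op_B m x X) (op_B m x Y)"
    and "op_A m x (ext_scale m c X) = ext_scale m c (op_A m x X)"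
    and "op_B m x (ext_scale m c X) = ext_scale m c (op_B m x X)"
proof -
  from assms obtain s t where s: "s \<in> ext_free m" "X = ext_rel m `` {s}"
    and t: "t \<in> ext_free m" "Y = ext_rel m `` {t}"
    by (metis ext_power_cases)
  interpret A: Vector_Spaces.linear fscale fscale "\<lambda>t. fextend (\<lambda>g. fextend (free_A g) t) x"
    by (rule fextend_fextend_linear)
  interpret B: Vector_Spaces.linear fscale fscale "\<lambda>t. fextend (\<lambda>g. fextend (free_B g) t) x"
    by (rule fextend_fextend_linear)
  note [simp] = op_A_class op_B_class ext_add_class ext_scale_class fextend_free_in_ext_free
    free.subspace_add[OF subspace_ext_free] free.subspace_scale[OF subspace_ext_free]
  show "op_A m x (ext_add m X Y) = ext_add m (op_A m x X) (op_A m x Y)"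
    and "op_B m x (ext_add m X Y) = ext_add m (op_B m x X) (op_B m x Y)"
    and "op_A m x (ext_scale m c X) = ext_scale m c (op_A m x X)"
    and "op_B m x (ext_scale m c X) = ext_scale m c (op_B m x X)"
    using s t by (simp_all add: A.add B.add A.scale B.scale)
qed

lemma op_linear_group_algebra:
  assumes "X \<in> ext_power m"
  shows "op_A m (x + y) X = ext_add m (op_A m x X) (op_A m y X)"
    and "op_B m (x + y) X = ext_add m (op_B m x X) (op_B m y X)"
    and "op_A m (fscale c x) X = ext_scale m c (op_A m x X)"
    and "op_B m (fscale c x) X = ext_scale m c (op_B m x X)"
proof -
  from assms obtain s where s: "s \<in> ext_free m" "X = ext_rel m `` {s}"
    by (metis ext_power_cases)
  interpret A: Vector_Spaces.linear fscale fscale "fextend (\<lambda>g. fextend (free_A g) s)"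
    by (rule linear_fextend)
  interpret B: Vector_Spaces.linear fscale fscale "fextend (\<lambda>g. fextend (free_B g) s)"
    by (rule linear_fextend)
  note [simp] = op_A_class op_B_class ext_add_class ext_scale_class fextend_free_in_ext_free
  show "op_A m (x + y) X = ext_add m (op_A m x X) (op_A m y X)"
    and "op_B m (x + y) X = ext_add m (op_B m x X) (op_B m y X)"
    and "op_A m (fscale c x) X = ext_scale m c (op_A m x X)"
    and "op_B m (fscale c x) X = ext_scale m c (op_B m x X)"
    using s by (simp_all add: A.add B.add A.scale B.scale)
qed

end

end

theory Submission
  imports Defs
begin

text \<open>
  On the exterior power, \<open>A\<close> is multiplicative, while \<open>B\<close> extends operators of \<open>V\<close> to
  derivations and hence preserves commutators.  Both identities already hold on the free space
  of tuples: in \<open>B(g) B(h)\<close> the terms in which \<open>g\<close> and \<open>h\<close> act on distinct slots are symmetric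
  in \<open>g\<close> and \<open>h\<close>, and the remaining ones add up to \<open>B(g h)\<close>.  So if \<open>A(x) = B(x)\<close> and
  \<open>A(y) = B(y)\<close>, then \<open>A([x, y]) = [A(x), A(y)] = [B(x), B(y)] = B([x, y])\<close>.
\<close>

text \<open>A finitely supported function is the finite sum of its \<open>single\<close> terms.
  Identities additive in an argument thereby reduce to scaled basis elements.\<close>

lemma poly_mapping_add_induct [case_names single add]:
  fixes p :: "'a \<Rightarrow>\<^sub>0 'b::comm_monoid_add"
  assumes single: "\<And>a c. P (Poly_Mapping.single a c)"
    and add: "\<And>p q. P p \<Longrightarrow> P q \<Longrightarrow> P (p + q)"
  shows "P p"
proof -
  have "P (\<Sum>a\<in>K. Poly_Mapping.single a (Poly_Mapping.lookup p a))" if "finite K" for K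
    using that
  proof (induction K rule: finite_induct)
    case empty
    \<comment> \<open>The empty sum is zero, that is, a \<open>single\<close> with coefficient 0 at
      any key.\<close>
    show ?case using single[of undefined 0] by simp
  qed (simp add: single add)
  moreover have "(\<Sum>a\<in>Poly_Mapping.keys p. Poly_Mapping.single a (Poly_Mapping.lookup p a)) = p"
    by (rule poly_mapping_eqI) (simp add: lookup_sum lookup_single when_def in_keys_iff)
  ultimately show ?thesis
    by (metis finite_keys)
qed

context group_representation
begin

text \<open>\<open>lift_A x\<close> induces \<open>op_A m x\<close> for every \<open>m\<close> at
  once, since it acts on tuples of all lengths; likewise \<open>lift_B\<close> below.\<close>

abbreviation lift_A :: "('g \<Rightarrow>\<^sub>0 'k) \<Rightarrow> ('v list \<Rightarrow>\<^sub>0 'k) \<Rightarrow> ('v list \<Rightarrow>\<^sub>0 'k)" where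
  "lift_A x t \<equiv> fextend (\<lambda>g. fextend (free_A g) t) x"

abbreviation lift_B :: "('g \<Rightarrow>\<^sub>0 'k) \<Rightarrow> ('v list \<Rightarrow>\<^sub>0 'k) \<Rightarrow> ('v list \<Rightarrow>\<^sub>0 'k)" where
  "lift_B x t \<equiv> fextend (\<lambda>g. fextend (free_B g) t) x"

lemma lift_null:
  assumes "t \<in> ext_null m"
  shows "lift_A x t \<in> ext_null m" and "lift_B x t \<in> ext_null m"
proof -
  interpret A: Vector_Spaces.linear fscale fscale "lift_A x" by (rule fextend_fextend_linear)
  interpret B: Vector_Spaces.linear fscale fscale "lift_B x" by (rule fextend_fextend_linear)
  have "lift_A x ` free.span (ext_relators m) \<subseteq> free.span (ext_null m)"
    "lift_B x ` free.span (ext_relators m) \<subseteq> free.span (ext_null m)"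
    using fextend_free_null unfolding A.span_image [symmetric] B.span_image [symmetric]
    by (intro free.span_mono; blast)+
  then show "lift_A x t \<in> ext_null m" "lift_B x t \<in> ext_null m"
    using assms by (auto simp: ext_null_def free.span_span)
qed

text \<open>Moves the problem from the quotient to representatives: afterwards only congruences
  modulo \<open>ext_null m\<close> have to be shown.\<close>

lemma lie_elements_iff:
  "x \<in> lie_elements \<longleftrightarrow>
    (\<forall>m\<le>dim UNIV. \<forall>t\<in>ext_free m. lift_A x t - lift_B x t \<in> ext_null m)"
proof -
  have "op_A m x = op_B m x \<longleftrightarrow>
      (\<forall>t\<in>ext_free m. lift_A x t - lift_B x t \<in> ext_null m)" (is "?L \<longleftrightarrow> ?R") for m
  proof
    assume L: ?L
    show ?R
    proof
      fix t assume t: "t \<in> ext_free m"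
      have "ext_rel m `` {lift_A x t} = ext_rel m `` {lift_B x t}"
        using L t by (simp flip: op_A_class op_B_class)
      then show "lift_A x t - lift_B x t \<in> ext_null m"
        using t by (simp add: ext_class_eq fextend_free_in_ext_free)
    qed
  next
    assume R: ?R
    \<comment> \<open>Both operators are \<open>undefined\<close> off \<open>ext_power m\<close>, so
      agreement on classes is enough.\<close>
    show ?L
    proof (rule extensionalityI[where A = "ext_power m"])
      show "op_A m x \<in> extensional (ext_power m)" "op_B m x \<in> extensional (ext_power m)"
        by (simp_all add: op_A_def op_B_def ext_induced_def)
      fix X assume "X \<in> ext_power m"
      then obtain t where "t \<in> ext_free m" "X = ext_rel m `` {t}" by (rule ext_power_cases)
      then show "op_A m x X = op_B m x X"
        using R by (simp add: op_A_class op_B_class ext_class_eq fextend_free_in_ext_free)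
    qed
  qed
  then show ?thesis by (simp add: lie_elements_def)
qed

lemma lift_add:
  "lift_A (x + y) t = lift_A x t + lift_A y t" "lift_A x (s + t) = lift_A x s + lift_A x t"
  "lift_B (x + y) t = lift_B x t + lift_B y t" "lift_B x (s + t) = lift_B x s + lift_B x t"
proof -
  have add: "f (p + q) = f p + f q" if "Vector_Spaces.linear fscale fscale f"
    for f :: "('c \<Rightarrow>\<^sub>0 'k) \<Rightarrow> ('v list \<Rightarrow>\<^sub>0 'k)" and p q
    using that unfolding Vector_Spaces.linear_def by (blast intro: module_hom.add)
  show "lift_A (x + y) t = lift_A x t + lift_A y t" "lift_A x (s + t) = lift_A x s + lift_A x t"
    "lift_B (x + y) t = lift_B x t + lift_B y t" "lift_B x (s + t) = lift_B x s + lift_B x t"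
    by (rule add[OF linear_fextend] add[OF fextend_fextend_linear])+
qed

lemma fextend_fscale: "fextend f (fscale c p) = fscale c (fextend f p)"
  using linear_fextend[of f] unfolding Vector_Spaces.linear_def by (blast intro: module_hom.scale)

lemma fextend_diff: "fextend f (p - q) = fextend f p - fextend f q"
  using linear_fextend[of f] unfolding Vector_Spaces.linear_def by (blast intro: module_hom.diff)

text \<open>Both sides are additive in \<open>x\<close>, \<open>y\<close> and \<open>t\<close>; on
  basis elements the claim is \<open>rep_add\<close> applied in each slot.\<close>

lemma lift_A_mult:
  "lift_A (x * y) t = lift_A x (lift_A y t)"
proof (induction x rule: poly_mapping_add_induct)
  case (single g a)
  show ?case
  proof (induction y rule: poly_mapping_add_induct)
    case (single h b)
    show ?case
    proof (induction t rule: poly_mapping_add_induct)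
      case (single vs c)
      have "map (rep (g + h)) vs = map (rep g) (map (rep h) vs)"
        by (simp add: rep_add)
      then show ?case
        by (simp add: mult_single fextend_fscale free_A_def mult_ac del: map_map)
    next
      case (add p q)
      then show ?case by (simp add: distrib_left distrib_right lift_add del: fextend_single)
    qed
  next
    case (add p q)
    then show ?case by (simp add: distrib_left distrib_right lift_add del: fextend_single)
  qed
next
  case (add p q)
  then show ?case by (simp add: distrib_left distrib_right lift_add del: fextend_single)
qed

text \<open>Here \<open>h\<close> acts in slot \<open>p\<close> and \<open>g\<close> in slot
  \<open>q\<close>. The terms with \<open>p = q\<close> compose to the action of
  \<open>g + h\<close> in one slot.\<close>

lemma fextend_free_B_free_B:
  "fextend (free_B g) (free_B h vs) =
    free_B (g + h) vs +
    (\<Sum>p<length vs. \<Sum>q\<in>{..<length vs} - {p}.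
      Poly_Mapping.single (vs[p := rep h (vs ! p), q := rep g (vs ! q)]) 1)"
proof -
  interpret e: Vector_Spaces.linear fscale fscale "fextend (free_B g)" by (rule linear_fextend)
  \<comment> \<open>The summand \<open>q = p\<close> is split off; in the others, slot
    \<open>q\<close> still holds its original entry.\<close>
  have "free_B g (vs[p := rep h (vs ! p)]) =
      Poly_Mapping.single (vs[p := rep (g + h) (vs ! p)]) 1 +
      (\<Sum>q\<in>{..<length vs} - {p}.
        Poly_Mapping.single (vs[p := rep h (vs ! p), q := rep g (vs ! q)]) 1)"
    if "p < length vs" for p
    using that by (simp add: free_B_def sum.remove[of _ p] rep_add)
  then show ?thesis
    by (simp add: free_B_def[of h] e.sum sum.distrib) (simp add: free_B_def)
qed

lemma fextend_free_B_commutator: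
  "fextend (free_B g) (free_B h vs) - fextend (free_B h) (free_B g vs) =
    free_B (g + h) vs - free_B (h + g) vs"
proof -
  let ?s = "\<lambda>g h p q. Poly_Mapping.single (vs[p := rep h (vs ! p), q := rep g (vs ! q)]) (1::'k)"
  let ?I = "{..<length vs}"
  have "(\<Sum>p\<in>?I. \<Sum>q\<in>?I - {p}. ?s g h p q) =
      (\<Sum>(p, q)\<in>(SIGMA p:?I. ?I - {p}). ?s g h p q)"
    by (simp add: sum.Sigma)
  also have "\<dots> = (\<Sum>(p, q)\<in>(SIGMA p:?I. ?I - {p}). ?s h g p q)"
    \<comment> \<open>Updates at distinct slots commute, so exchanging \<open>p\<close> and
      \<open>q\<close> exchanges the roles of \<open>g\<close> and \<open>h\<close>.\<close>
    by (rule sum.reindex_bij_witness[of _ prod.swap prod.swap])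
      (auto intro!: arg_cong[where f = "\<lambda>vs. Poly_Mapping.single vs _"] list_update_swap)
  also have "\<dots> = (\<Sum>p\<in>?I. \<Sum>q\<in>?I - {p}. ?s h g p q)"
    by (simp add: sum.Sigma)
  finally show ?thesis by (simp add: fextend_free_B_free_B)
qed

text \<open>The mixed terms of a single product remain and cancel only in the commutator, so the
  bracket replaces the product of \<open>lift_A_mult\<close>. The reduction to basis elements is the
  same.\<close>

lemma lift_B_commutator:
  "lift_B (lie_bracket x y) t = lift_B x (lift_B y t) - lift_B y (lift_B x t)"
proof (induction x rule: poly_mapping_add_induct)
  case (single g a)
  show ?case
  proof (induction y rule: poly_mapping_add_induct)
    case (single h b)
    show ?case
    proof (induction t rule: poly_mapping_add_induct)
      case (single vs c)
      have "fscale (a * b * c) (free_B (g + h) vs - free_B (h + g) vs) =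
          fscale (a * b * c)
            (fextend (free_B g) (free_B h vs) - fextend (free_B h) (free_B g vs))"
        by (simp only: fextend_free_B_commutator)
      then show ?case
        by (simp add: lie_bracket_def mult_single fextend_diff fextend_fscale
            free.scale_right_diff_distrib mult_ac)
    next
      case (add p q)
      then show ?case by (simp add: lie_bracket_def lift_add fextend_diff algebra_simps del: fextend_single)
    qed
  next
    case (add p q)
    then show ?case by (simp add: lie_bracket_def lift_add fextend_diff algebra_simps del: fextend_single)
  qed
next
  case (add p q)
  then show ?case by (simp add: lie_bracket_def lift_add fextend_diff algebra_simps del: fextend_single)
qed

lemma subspace_ext_null: "free.subspace (ext_null m)"
  by (simp add: ext_null_def)

lemma subspace_lie_elements: "free.subspace lie_elements"
proof (rule free.subspaceI)
  show "0 \<in> lie_elements"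
    by (simp add: lie_elements_iff fextend_def free.subspace_0[OF subspace_ext_null])
  show "x + y \<in> lie_elements" if "x \<in> lie_elements" "y \<in> lie_elements" for x y
  proof -
    have "lift_A (x + y) t - lift_B (x + y) t =
        (lift_A x t - lift_B x t) + (lift_A y t - lift_B y t)" for t
      by (simp add: lift_add)
    then show ?thesis
      using that by (simp add: lie_elements_iff free.subspace_add[OF subspace_ext_null])
  qed
  show "fscale c x \<in> lie_elements" if "x \<in> lie_elements" for c x
    using that free.subspace_scale[OF subspace_ext_null, of _ _ c]
    by (simp add: lie_elements_iff fextend_fscale flip: free.scale_right_diff_distrib)
qed

text \<open>The operators are exchanged one at a time: the outer one because \<open>x\<close> is a
  Lie element and \<open>lift_A y t\<close> stays in \<open>ext_free m\<close>, the inner one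
  because \<open>lift_B x\<close> preserves \<open>ext_null m\<close>.\<close>

lemma lift_A_lift_A_minus_lift_B_lift_B:
  assumes x: "x \<in> lie_elements" and y: "y \<in> lie_elements"
    and m: "m \<le> dim UNIV" and t: "t \<in> ext_free m"
  shows "lift_A x (lift_A y t) - lift_B x (lift_B y t) \<in> ext_null m"
proof -
  have "lift_A x (lift_A y t) - lift_B x (lift_A y t) \<in> ext_null m"
    using x m t by (simp add: lie_elements_iff fextend_free_in_ext_free)
  moreover have "lift_B x (lift_A y t - lift_B y t) \<in> ext_null m"
    using y m t by (simp add: lie_elements_iff lift_null)
  moreover have "lift_A x (lift_A y t) - lift_B x (lift_B y t) =
      (lift_A x (lift_A y t) - lift_B x (lift_A y t)) + lift_B x (lift_A y t - lift_B y t)"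
    using lift_add(4)[where s = "lift_A y t - lift_B y t" and t = "lift_B y t" and x = x] by simp
  ultimately show ?thesis
    by (simp only: free.subspace_add[OF subspace_ext_null])
qed

lemma lie_bracket_in_lie_elements:
  assumes x: "x \<in> lie_elements" and y: "y \<in> lie_elements"
  shows "lie_bracket x y \<in> lie_elements"
  unfolding lie_elements_iff
proof (intro allI impI ballI)
  fix m t assume mt: "m \<le> dim UNIV" "t \<in> ext_free m"
  have "lift_A (lie_bracket x y) t - lift_B (lie_bracket x y) t =
      (lift_A x (lift_A y t) - lift_B x (lift_B y t)) -
      (lift_A y (lift_A x t) - lift_B y (lift_B x t))"
    \<comment> \<open>The \<open>lift_B\<close> term is rewritten while \<open>lie_bracket\<close>
      is still folded; only then is the bracket expanded for \<open>lift_A\<close>.\<close>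
    by (simp add: lift_B_commutator) (simp add: lie_bracket_def fextend_diff lift_A_mult)
  then show "lift_A (lie_bracket x y) t - lift_B (lie_bracket x y) t \<in> ext_null m"
    using free.subspace_diff[OF subspace_ext_null
        lift_A_lift_A_minus_lift_B_lift_B[OF x y mt] lift_A_lift_A_minus_lift_B_lift_B[OF y x mt]]
    by (simp only:)
qed

end

theorem corollary1:
  fixes scale :: "'k::field \<Rightarrow> 'v::ab_group_add \<Rightarrow> 'v"
    and Basis :: "'v set"
    and rep :: "'g::group_add \<Rightarrow> 'v \<Rightarrow> 'v"
  assumes "finite_dimensional_vector_space scale Basis"
    and "group_representation scale rep"
  shows "lie_subalgebra (group_representation.lie_elements scale rep)"
proof -
  interpret group_representation scale rep by (rule assms(2))
  show ?thesis
    by (simp add: lie_subalgebra_def subspace_lie_elements lie_bracket_in_lie_elements)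
qed

end
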